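(* Let $\mathbf{C}$ be a category in which every morphism is monic and $\hom_{\mathbf{C}}(A,B)$ is finite for all objects $A,B$, and let $\mathbf{D}$ be a hereditary subcategory of $\mathbf{C}$. If $\mathbf{C}$ has the canonical Ramsey property and $\mathbf{D}$ is closed for binary diagrams, then $\mathbf{D}$ has the canonical Ramsey property.
   Context: A morphism $f$ is monic if $f\cdot g=f\cdot h$ implies $g=h$. $\mathbf{D}$ is a hereditary subcategory of $\mathbf{C}$ if it is a full subcategory and for all $D\in\mathrm{Ob}(\mathbf{D})$, $C\in\mathrm{Ob}(\mathbf{C})$, $\hom_{\mathbf{C}}(C,D)\neq\varnothing$ implies $C\in\mathrm{Ob}(\mathbf{D})$. A binary digraph is a finite acyclic bipartite digraph in which all arrows go from one class of vertices (bottom row) to the other (top row) and every vertex of the bottom row has out-degree 2. A diagram of shape $\Delta$ in a category is a multigraph homomorphism from $\Delta$ to the category (vertices to objects, arrows $\delta\to\gamma$ to morphisms $F(\delta)\to F(\gamma)$). A binary diagram in $\mathbf{C}$ is a diagram $F:\Delta\to\mathbf{C}$ with $\Delta$ a binary digraph such that $F$ maps all bottom-row vertices to one and the same object and all top-row vertices to one and the same object. A commutative cocone over $F$ in a category is an object $C$ with morphisms $e_\delta:F(\delta)\to C$ for all vertices $\delta$ such that $e_\gamma\cdot F(g)=e_\delta$ for every arrow $g:\delta\to\gamma$. $\mathbf{D}$ is closed for binary diagrams (in $\mathbf{C}$) if every binary diagram in $\mathbf{D}$ that has a commutative cocone in $\mathbf{C}$ has a commutative cocone in $\mathbf{D}$.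 For objects $A,B,C$ of a category, $C\xrightarrow{can}(B)^A$ means: for every $\chi:\hom(A,C)\to\omega$ there exist $w\in\hom(B,C)$, an object $Q$ and $q\in\hom(Q,A)$ such that for all $f,g\in\hom(A,B)$, $\chi(w\cdot f)=\chi(w\cdot g)$ iff $f\cdot q=g\cdot q$. A category has the canonical Ramsey property if for all objects $A,B$ with $\hom(A,B)\neq\varnothing$ there is an object $C$ with $C\xrightarrow{can}(B)^A$. *)

theory Defs
  imports "Graph_Theory.Digraph"
begin

record ('o, 'm) cat =
  obj :: "'o set"
  mor :: "'m set"
  src :: "'m \<Rightarrow> 'o"
  tgt :: "'m \<Rightarrow> 'o"
  ident :: "'o \<Rightarrow> 'm"
  comp :: "'m \<Rightarrow> 'm \<Rightarrow> 'm"  (infixl "\<cdot>\<index>" 70)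

definition hom :: "('o, 'm) cat \<Rightarrow> 'o \<Rightarrow> 'o \<Rightarrow> 'm set" where
  "hom C A B = {f \<in> mor C. src C f = A \<and> tgt C f = B}"

text \<open>The composite \<open>g \<cdot> f\<close> means \<open>g\<close> after \<open>f\<close>; it is only constrained when the
  target of \<open>f\<close> is the source of \<open>g\<close>.\<close>

locale category =
  fixes C :: "('o, 'm) cat" (structure)
  assumes src_in_obj: "f \<in> mor C \<Longrightarrow> src C f \<in> obj C"
    and tgt_in_obj: "f \<in> mor C \<Longrightarrow> tgt C f \<in> obj C"
    and ident_in_hom: "A \<in> obj C \<Longrightarrow> ident C A \<in> hom C A A"
    and comp_in_hom: "f \<in> hom C X Y \<Longrightarrow> g \<in> hom C Y Z \<Longrightarrow> g \<cdot> f \<in> hom C X Z"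
    and ident_right: "f \<in> hom C X Y \<Longrightarrow> f \<cdot> ident C X = f"
    and ident_left: "f \<in> hom C X Y \<Longrightarrow> ident C Y \<cdot> f = f"
    and comp_assoc: "f \<in> hom C W X \<Longrightarrow> g \<in> hom C X Y \<Longrightarrow> h \<in> hom C Y Z
      \<Longrightarrow> (h \<cdot> g) \<cdot> f = h \<cdot> (g \<cdot> f)"

definition monic :: "('o, 'm) cat \<Rightarrow> 'm \<Rightarrow> bool" where
  "monic C f \<longleftrightarrow> f \<in> mor C \<and>
     (\<forall>X \<in> obj C. \<forall>g \<in> hom C X (src C f). \<forall>h \<in> hom C X (src C f).
        f \<cdot>\<^bsub>C\<^esub> g = f \<cdot>\<^bsub>C\<^esub> h \<longrightarrow> g = h)"

definition subcategory :: "('o, 'm) cat \<Rightarrow> ('o, 'm) cat \<Rightarrow> bool" where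
  "subcategory D C \<longleftrightarrow> category D \<and> category C \<and>
     obj D \<subseteq> obj C \<and> mor D \<subseteq> mor C \<and>
     (\<forall>f \<in> mor D. src D f = src C f \<and> tgt D f = tgt C f) \<and>
     (\<forall>A \<in> obj D. ident D A = ident C A) \<and>
     (\<forall>f \<in> mor D. \<forall>g \<in> mor D. tgt D f = src D g \<longrightarrow> g \<cdot>\<^bsub>D\<^esub> f = g \<cdot>\<^bsub>C\<^esub> f)"

definition full_subcategory :: "('o, 'm) cat \<Rightarrow> ('o, 'm) cat \<Rightarrow> bool" where
  "full_subcategory D C \<longleftrightarrow> subcategory D C \<and>
     (\<forall>A \<in> obj D. \<forall>B \<in> obj D. hom D A B = hom C A B)"

definition hereditary_subcategory :: "('o, 'm) cat \<Rightarrow> ('o, 'm) cat \<Rightarrow> bool" where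
  "hereditary_subcategory D C \<longleftrightarrow> full_subcategory D C \<and>
     (\<forall>B \<in> obj D. \<forall>A \<in> obj C. hom C A B \<noteq> {} \<longrightarrow> A \<in> obj D)"

definition binary_digraph :: "('v, 'a) pre_digraph \<Rightarrow> 'v set \<Rightarrow> 'v set \<Rightarrow> bool" where
  "binary_digraph \<Delta> bottom top_row \<longleftrightarrow> digraph \<Delta> \<and> acyclic (arcs_ends \<Delta>) \<and>
     verts \<Delta> = bottom \<union> top_row \<and> bottom \<inter> top_row = {} \<and>
     (\<forall>a \<in> arcs \<Delta>. tail \<Delta> a \<in> bottom \<and> head \<Delta> a \<in> top_row) \<and>
     (\<forall>\<delta> \<in> bottom. out_degree \<Delta> \<delta> = 2)"

text \<open>A diagram is given by its action \<open>F\<close> on vertices and its action \<open>\<phi>\<close> on arrows.\<close>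

definition diagram ::
  "('o, 'm) cat \<Rightarrow> ('v, 'a) pre_digraph \<Rightarrow> ('v \<Rightarrow> 'o) \<Rightarrow> ('a \<Rightarrow> 'm) \<Rightarrow> bool" where
  "diagram C \<Delta> F \<phi> \<longleftrightarrow>
     (\<forall>\<delta> \<in> verts \<Delta>. F \<delta> \<in> obj C) \<and>
     (\<forall>a \<in> arcs \<Delta>. \<phi> a \<in> hom C (F (tail \<Delta> a)) (F (head \<Delta> a)))"

definition binary_diagram ::
  "('o, 'm) cat \<Rightarrow> ('v, 'a) pre_digraph \<Rightarrow> ('v \<Rightarrow> 'o) \<Rightarrow> ('a \<Rightarrow> 'm) \<Rightarrow> bool" where
  "binary_diagram C \<Delta> F \<phi> \<longleftrightarrow> diagram C \<Delta> F \<phi> \<and>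
     (\<exists>bottom top_row. binary_digraph \<Delta> bottom top_row \<and>
        (\<exists>A. \<forall>\<delta> \<in> bottom. F \<delta> = A) \<and> (\<exists>B. \<forall>\<gamma> \<in> top_row. F \<gamma> = B))"

definition commutative_cocone ::
  "('o, 'm) cat \<Rightarrow> ('v, 'a) pre_digraph \<Rightarrow> ('v \<Rightarrow> 'o) \<Rightarrow> ('a \<Rightarrow> 'm) \<Rightarrow> 'o \<Rightarrow> ('v \<Rightarrow> 'm) \<Rightarrow> bool" where
  "commutative_cocone C \<Delta> F \<phi> X e \<longleftrightarrow> X \<in> obj C \<and>
     (\<forall>\<delta> \<in> verts \<Delta>. e \<delta> \<in> hom C (F \<delta>) X) \<and>
     (\<forall>a \<in> arcs \<Delta>. e (head \<Delta> a) \<cdot>\<^bsub>C\<^esub> \<phi> a = e (tail \<Delta> a))"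

text \<open>Shapes are finite, so up to isomorphism their vertices and arrows are natural numbers;
  quantifying over digraphs on \<^typ>\<open>nat\<close> therefore covers all binary diagrams.\<close>

definition closed_for_binary_diagrams :: "('o, 'm) cat \<Rightarrow> ('o, 'm) cat \<Rightarrow> bool" where
  "closed_for_binary_diagrams D C \<longleftrightarrow>
     (\<forall>(\<Delta> :: (nat, nat) pre_digraph) F \<phi>.
        binary_diagram D \<Delta> F \<phi> \<and> (\<exists>X e. commutative_cocone C \<Delta> F \<phi> X e)
        \<longrightarrow> (\<exists>X e. commutative_cocone D \<Delta> F \<phi> X e))"

text \<open>\<open>can_arrow C X B A\<close> is the relation usually written \<open>X \<longrightarrow> (B)\<^sup>A\<close> with superscript
  ``can''. A colouring of \<open>hom C A X\<close> is represented by a total function, of which only the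
  values on \<open>hom C A X\<close> matter.\<close>

definition can_arrow :: "('o, 'm) cat \<Rightarrow> 'o \<Rightarrow> 'o \<Rightarrow> 'o \<Rightarrow> bool" where
  "can_arrow C X B A \<longleftrightarrow>
     (\<forall>\<chi> :: 'm \<Rightarrow> nat. \<exists>w \<in> hom C B X. \<exists>Q \<in> obj C. \<exists>q \<in> hom C Q A.
        \<forall>f \<in> hom C A B. \<forall>g \<in> hom C A B.
          \<chi> (w \<cdot>\<^bsub>C\<^esub> f) = \<chi> (w \<cdot>\<^bsub>C\<^esub> g) \<longleftrightarrow> f \<cdot>\<^bsub>C\<^esub> q = g \<cdot>\<^bsub>C\<^esub> q)"

definition canonical_Ramsey :: "('o, 'm) cat \<Rightarrow> bool" where
  "canonical_Ramsey C \<longleftrightarrow>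
     (\<forall>A \<in> obj C. \<forall>B \<in> obj C. hom C A B \<noteq> {} \<longrightarrow> (\<exists>X \<in> obj C. can_arrow C X B A))"

end

theory Submission
  imports Defs
begin

text \<open>Take \<open>X\<close> with \<open>X \<longrightarrow> (B)\<^sup>A\<close> canonically in \<open>C\<close>. All coincidences \<open>d \<cdot> u = e \<cdot> v\<close> with
  \<open>d \<noteq> e\<close> in \<open>hom C B X\<close> and \<open>u, v\<close> in \<open>hom C A B\<close> form a binary diagram in \<open>D\<close> with tip \<open>X\<close> in
  \<open>C\<close>; coincidences with \<open>d = e\<close> are trivial because \<open>d\<close> is monic. A cocone in \<open>D\<close> gives \<open>Y\<close> and
  morphisms \<open>k e : B \<rightarrow> Y\<close> satisfying the same coincidences, so a colouring \<open>\<chi>\<close> of \<open>hom D A Y\<close>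
  pulls back to a well-defined colouring \<open>e \<cdot> u \<mapsto> \<chi> (k e \<cdot> u)\<close>, and a canonical \<open>w\<close> for the
  latter yields the canonical \<open>k w\<close> for \<open>\<chi>\<close>.\<close>

text \<open>Top vertices are \<open>{..<n}\<close>; bottom vertex \<open>n + j\<close> sends arrow \<open>2 * j\<close> to \<open>p j\<close> and
  arrow \<open>2 * j + 1\<close> to \<open>q j\<close>.\<close>

definition pair_digraph :: "nat \<Rightarrow> nat \<Rightarrow> (nat \<Rightarrow> nat) \<Rightarrow> (nat \<Rightarrow> nat) \<Rightarrow> (nat, nat) pre_digraph" where
  "pair_digraph n m p q =
     \<lparr>verts = {..<n + m}, arcs = {..<2 * m},
      tail = (\<lambda>a. n + a div 2), head = (\<lambda>a. if even a then p (a div 2) else q (a div 2))\<rparr>"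

text \<open>A \<open>digraph\<close> has neither loops nor parallel arcs. Arcs with different halves
  leave different bottom vertices, and the two arcs of one bottom vertex end apart because
  \<open>p j \<noteq> q j\<close>.\<close>

lemma binary_digraph_pair_digraph:
  assumes p: "\<And>j. j < m \<Longrightarrow> p j < n" and q: "\<And>j. j < m \<Longrightarrow> q j < n"
    and neq: "\<And>j. j < m \<Longrightarrow> p j \<noteq> q j"
  shows "binary_digraph (pair_digraph n m p q) {n..<n + m} {..<n}"
proof -
  let ?G = "pair_digraph n m p q"
  have half: "a div 2 < m" if "a < 2 * m" for a :: nat
    using that by auto
  have head: "head ?G a < n" if "a \<in> arcs ?G" for a
    using that half[of a] p q by (auto simp: pair_digraph_def)
  have tail: "tail ?G a \<in> {n..<n + m}" if "a \<in> arcs ?G" for a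
    using that half[of a] by (auto simp: pair_digraph_def)
  have eq: "a = b" if "a \<in> arcs ?G" "b \<in> arcs ?G" "arc_to_ends ?G a = arc_to_ends ?G b" for a b
  proof -
    have ab: "a div 2 = b div 2" "a div 2 < m"
      using that half[of a] by (auto simp: pair_digraph_def arc_to_ends_def)
    have "even a = even b"
      using that ab neq[of "a div 2"]
      by (auto simp: pair_digraph_def arc_to_ends_def split: if_splits)
    with ab(1) show "a = b"
      by presburger
  qed
  have "digraph ?G"
  proof
    fix a assume a: "a \<in> arcs ?G"
    show "tail ?G a \<in> verts ?G" using tail[OF a] by (auto simp: pair_digraph_def)
    show "head ?G a \<in> verts ?G" using head[OF a] by (auto simp: pair_digraph_def)
    show "tail ?G a \<noteq> head ?G a" using tail[OF a] head[OF a] by auto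
  qed (use eq in \<open>auto simp: pair_digraph_def\<close>)
  \<comment> \<open>Bottom vertices are numbered above the top ones, so every arc descends in the
    order of the natural numbers.\<close>
  moreover have "acyclic (arcs_ends ?G)"
  proof (rule acyclic_subset)
    show "acyclic (less_than\<inverse>)"
      by (simp add: wf_acyclic)
    show "arcs_ends ?G \<subseteq> less_than\<inverse>"
      using head tail by (fastforce simp: arcs_ends_def arc_to_ends_def)
  qed
  moreover have "out_degree ?G v = 2" if v: "v \<in> {n..<n + m}" for v
  proof -
    have "out_arcs ?G v = {2 * (v - n), 2 * (v - n) + 1}"
      using v by (auto simp: pair_digraph_def out_arcs_def)
    then show ?thesis
      by (simp add: out_degree_def)
  qed
  moreover have "verts ?G = {n..<n + m} \<union> {..<n}"
    by (auto simp: pair_digraph_def)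
  ultimately show ?thesis
    using head tail by (auto simp: binary_digraph_def)
qed

text \<open>Closedness speaks of shapes on natural numbers, so the morphisms and the equations
  between them come enumerated. Bottom vertices only record the common value of the two sides and
  drop out of the conclusion.\<close>

lemma closed_for_binary_diagrams_indexed:
  fixes n m :: nat and p q :: "nat \<Rightarrow> nat" and e u v :: "nat \<Rightarrow> 'm"
  assumes "category C" and closed: "closed_for_binary_diagrams D C"
    and full: "full_subcategory D C"
    and A: "A \<in> obj D" and B: "B \<in> obj D" and X: "X \<in> obj C"
    and e: "\<And>i. i < n \<Longrightarrow> e i \<in> hom C B X"
    and uv: "\<And>j. j < m \<Longrightarrow> u j \<in> hom C A B" "\<And>j. j < m \<Longrightarrow> v j \<in> hom C A B"
    and pq: "\<And>j. j < m \<Longrightarrow> p j < n" "\<And>j. j < m \<Longrightarrow> q j < n" "\<And>j. j < m \<Longrightarrow> p j \<noteq> q j"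
    and coincide: "\<And>j. j < m \<Longrightarrow> e (p j) \<cdot>\<^bsub>C\<^esub> u j = e (q j) \<cdot>\<^bsub>C\<^esub> v j"
  obtains Y d where "Y \<in> obj D" "\<And>i. i < n \<Longrightarrow> d i \<in> hom D B Y"
    "\<And>j. j < m \<Longrightarrow> d (p j) \<cdot>\<^bsub>D\<^esub> u j = d (q j) \<cdot>\<^bsub>D\<^esub> v j"
proof -
  interpret category C by fact
  let ?G = "pair_digraph n m p q"
  define F where "F i = (if i < n then B else A)" for i :: nat
  define \<phi> where "\<phi> a = (if even a then u (a div 2) else v (a div 2))" for a :: nat
  \<comment> \<open>The leg at a bottom vertex is written through the \<open>p\<close> side of its
    coincidence; \<open>coincide\<close> makes the odd arrows commute as well.\<close>
  define c where "c i = (if i < n then e i else e (p (i - n)) \<cdot>\<^bsub>C\<^esub> u (i - n))" for i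
  have half: "a div 2 < m" if "a < 2 * m" for a :: nat
    using that by auto
  have homAB: "hom D A B = hom C A B"
    using full A B by (simp add: full_subcategory_def)
  have "diagram D ?G F \<phi>"
    using A B uv half pq by (auto simp: diagram_def F_def \<phi>_def pair_digraph_def homAB)
  then have "binary_diagram D ?G F \<phi>"
    unfolding binary_diagram_def
    by (intro conjI exI[of _ "{n..<n + m}"] exI[of _ "{..<n}"] exI[of _ A] exI[of _ B]
        binary_digraph_pair_digraph) (auto simp: pq F_def)
  moreover have "commutative_cocone C ?G F \<phi> X c"
    unfolding commutative_cocone_def
  proof (intro conjI ballI)
    fix i assume "i \<in> verts ?G"
    then show "c i \<in> hom C (F i) X"
      using e pq uv by (auto simp: c_def F_def pair_digraph_def intro!: comp_in_hom[where Y = B])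
  next
    fix a assume "a \<in> arcs ?G"
    then show "c (head ?G a) \<cdot>\<^bsub>C\<^esub> \<phi> a = c (tail ?G a)"
      using half[of a] pq coincide by (auto simp: c_def \<phi>_def pair_digraph_def)
  qed (fact X)
  ultimately obtain Y d where cocone: "commutative_cocone D ?G F \<phi> Y d"
    using closed unfolding closed_for_binary_diagrams_def by blast
  show thesis
  proof (rule that)
    show "Y \<in> obj D"
      using cocone by (simp add: commutative_cocone_def)
    show "d i \<in> hom D B Y" if "i < n" for i
    proof -
      have "i \<in> verts ?G"
        using that by (simp add: pair_digraph_def)
      then have "d i \<in> hom D (F i) Y"
        using cocone by (simp add: commutative_cocone_def)
      with that show ?thesis by (simp add: F_def)
    qed
    show "d (p j) \<cdot>\<^bsub>D\<^esub> u j = d (q j) \<cdot>\<^bsub>D\<^esub> v j" if "j < m" for j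
    proof -
      \<comment> \<open>Arrows \<open>2 * j\<close> and \<open>2 * j + 1\<close> leave the same
        bottom vertex, so both composites equal \<open>d (n + j)\<close>.\<close>
      have arr: "d (head ?G a) \<cdot>\<^bsub>D\<^esub> \<phi> a = d (tail ?G a)" if "a < 2 * m" for a
        using cocone that by (auto simp: commutative_cocone_def pair_digraph_def)
      show ?thesis
        using arr[of "2 * j"] arr[of "2 * j + 1"] that by (simp add: pair_digraph_def \<phi>_def)
    qed
  qed
qed

text \<open>A coincidence with \<open>d = e\<close> would give two parallel arrows, which a digraph
  forbids; hence it stays out of the diagram and is settled by cancellation. Finite hom-sets keep
  the diagram finite.\<close>

lemma closed_for_binary_diagrams_coincidences:
  assumes "category C" and mono: "\<forall>f \<in> mor C. monic C f"
    and closed: "closed_for_binary_diagrams D C"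
    and full: "full_subcategory D C"
    and A: "A \<in> obj D" and B: "B \<in> obj D" and X: "X \<in> obj C"
    and fin: "finite (hom C A B)" "finite (hom C B X)"
  obtains Y k where "Y \<in> obj D" "\<And>e. e \<in> hom C B X \<Longrightarrow> k e \<in> hom D B Y"
    "\<And>d e u v. \<lbrakk>d \<in> hom C B X; e \<in> hom C B X; u \<in> hom C A B; v \<in> hom C A B;
       d \<cdot>\<^bsub>C\<^esub> u = e \<cdot>\<^bsub>C\<^esub> v\<rbrakk> \<Longrightarrow> k d \<cdot>\<^bsub>D\<^esub> u = k e \<cdot>\<^bsub>D\<^esub> v"
proof -
  let ?H = "hom C B X" and ?K = "hom C A B"
  define R where "R = {(d, e, u, v). d \<in> ?H \<and> e \<in> ?H \<and> u \<in> ?K \<and> v \<in> ?K \<and> d \<noteq> e \<and>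
    d \<cdot>\<^bsub>C\<^esub> u = e \<cdot>\<^bsub>C\<^esub> v}"
  have "finite R"
    by (rule finite_subset[of _ "?H \<times> ?H \<times> ?K \<times> ?K"]) (auto simp: R_def fin)
  then obtain r where r: "bij_betw r {0..<card R} R"
    using ex_bij_betw_nat_finite by blast
  obtain h where h: "bij_betw h {0..<card ?H} ?H"
    using ex_bij_betw_nat_finite fin(2) by blast
  \<comment> \<open>One fixed inverse of \<open>h\<close> gives each morphism a single top vertex,
    shared by all coincidences in which it occurs, and keeps distinct morphisms apart.\<close>
  define t where "t = inv_into {0..<card ?H} h"
  have t: "t e < card ?H" "h (t e) = e" if "e \<in> ?H" for e
    using that h inv_into_into[of e h "{0..<card ?H}"]
    by (auto simp: t_def bij_betw_def f_inv_into_f)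
  have rR: "r j \<in> R" if "j < card R" for j
    using bij_betwE[OF r] that by simp
  obtain Y d where Y: "Y \<in> obj D" and d: "\<And>i. i < card ?H \<Longrightarrow> d i \<in> hom D B Y"
    and rel: "\<And>j. j < card R \<Longrightarrow> d (t (fst (r j))) \<cdot>\<^bsub>D\<^esub> fst (snd (snd (r j)))
      = d (t (fst (snd (r j)))) \<cdot>\<^bsub>D\<^esub> snd (snd (snd (r j)))"
  proof (rule closed_for_binary_diagrams_indexed[OF assms(1) closed full A B X,
      where n = "card ?H" and e = h and m = "card R" and p = "\<lambda>j. t (fst (r j))"
        and q = "\<lambda>j. t (fst (snd (r j)))" and u = "\<lambda>j. fst (snd (snd (r j)))"
        and v = "\<lambda>j. snd (snd (snd (r j)))"])
    show "h i \<in> ?H" if "i < card ?H" for i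
      using bij_betwE[OF h] that by simp
    show "t (fst (r j)) \<noteq> t (fst (snd (r j)))" if "j < card R" for j
      using rR[OF that] t(2)[of "fst (r j)"] t(2)[of "fst (snd (r j))"] by (auto simp: R_def)
  qed (use rR in \<open>force simp: R_def t\<close>)+
  show thesis
  proof (rule that[OF Y])
    show "d (t e) \<in> hom D B Y" if "e \<in> ?H" for e
      using d t(1) that by blast
    fix a b u v
    assume in_hom: "a \<in> ?H" "b \<in> ?H" "u \<in> ?K" "v \<in> ?K" and eq: "a \<cdot>\<^bsub>C\<^esub> u = b \<cdot>\<^bsub>C\<^esub> v"
    show "d (t a) \<cdot>\<^bsub>D\<^esub> u = d (t b) \<cdot>\<^bsub>D\<^esub> v"
    proof (cases "a = b")
      case True
      have "monic C a" "src C a = B" "A \<in> obj C"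
        using in_hom mono full A
        by (auto simp: hom_def full_subcategory_def subcategory_def)
      then have "u = v"
        using in_hom eq True by (auto simp: monic_def)
      with True show ?thesis by simp
    next
      case False
      then have "(a, b, u, v) \<in> r ` {0..<card R}"
        unfolding bij_betw_imp_surj_on[OF r] using in_hom eq by (simp add: R_def)
      then obtain j where "j < card R" "r j = (a, b, u, v)"
        by (elim imageE) simp
      with rel[of j] show ?thesis by simp
    qed
  qed
qed

theorem theorem4p1:
  fixes C D :: "('o, 'm) cat"
  assumes "category C"
    and "\<forall>f \<in> mor C. monic C f"
    and "\<forall>A \<in> obj C. \<forall>B \<in> obj C. finite (hom C A B)"
    and "hereditary_subcategory D C"
    and "canonical_Ramsey C"
    and "closed_for_binary_diagrams D C"
  shows "canonical_Ramsey D"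
  unfolding canonical_Ramsey_def
proof (intro ballI impI)
  fix A B assume A: "A \<in> obj D" and B: "B \<in> obj D" and "hom D A B \<noteq> {}"
  have full: "full_subcategory D C"
    and hered: "\<And>Q P. P \<in> obj D \<Longrightarrow> Q \<in> obj C \<Longrightarrow> hom C Q P \<noteq> {} \<Longrightarrow> Q \<in> obj D"
    using assms(4) by (auto simp: hereditary_subcategory_def)
  have sub: "subcategory D C"
    and hom_eq: "\<And>P Q. P \<in> obj D \<Longrightarrow> Q \<in> obj D \<Longrightarrow> hom D P Q = hom C P Q"
    using full by (auto simp: full_subcategory_def)
  have AC: "A \<in> obj C" and BC: "B \<in> obj C"
    using sub A B by (auto simp: subcategory_def)
  obtain X where X: "X \<in> obj C" and can: "can_arrow C X B A"
    using assms(5) AC BC \<open>hom D A B \<noteq> {}\<close> hom_eq[OF A B]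
    unfolding canonical_Ramsey_def by metis
  have fin: "finite (hom C A B)" "finite (hom C B X)"
    using assms(3) AC BC X by auto
  obtain Y k where Y: "Y \<in> obj D" and k: "\<And>e. e \<in> hom C B X \<Longrightarrow> k e \<in> hom D B Y"
    and rel: "\<And>d e u v. \<lbrakk>d \<in> hom C B X; e \<in> hom C B X; u \<in> hom C A B; v \<in> hom C A B;
       d \<cdot>\<^bsub>C\<^esub> u = e \<cdot>\<^bsub>C\<^esub> v\<rbrakk> \<Longrightarrow> k d \<cdot>\<^bsub>D\<^esub> u = k e \<cdot>\<^bsub>D\<^esub> v"
    using closed_for_binary_diagrams_coincidences[OF assms(1,2,6) full A B X fin] by metis
  have "can_arrow D Y B A"
    unfolding can_arrow_def
  proof
    fix \<chi> :: "'m \<Rightarrow> nat"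
    \<comment> \<open>\<open>P\<close> is the graph of the map
      \<open>e \<cdot> u \<mapsto> k e \<cdot> u\<close>, single-valued by \<open>rel\<close>. Off
      such composites \<open>\<chi>'\<close> is arbitrary, but \<open>canon\<close> evaluates it
      only at composites \<open>w \<cdot> f\<close>.\<close>
    define P where "P x y \<longleftrightarrow> (\<exists>e \<in> hom C B X. \<exists>u \<in> hom C A B. x = e \<cdot>\<^bsub>C\<^esub> u \<and> y = k e \<cdot>\<^bsub>D\<^esub> u)"
      for x y
    define \<chi>' where "\<chi>' x = \<chi> (THE y. P x y)" for x
    have pull: "\<chi>' (e \<cdot>\<^bsub>C\<^esub> u) = \<chi> (k e \<cdot>\<^bsub>D\<^esub> u)" if "e \<in> hom C B X" "u \<in> hom C A B" for e u
    proof -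
      have "(THE y. P (e \<cdot>\<^bsub>C\<^esub> u) y) = k e \<cdot>\<^bsub>D\<^esub> u"
        using that rel unfolding P_def by (intro the_equality) (blast, metis)
      then show ?thesis by (simp add: \<chi>'_def)
    qed
    obtain w Q q where w: "w \<in> hom C B X" and Q: "Q \<in> obj C" and q: "q \<in> hom C Q A"
      and canon: "\<And>f g. f \<in> hom C A B \<Longrightarrow> g \<in> hom C A B \<Longrightarrow>
        \<chi>' (w \<cdot>\<^bsub>C\<^esub> f) = \<chi>' (w \<cdot>\<^bsub>C\<^esub> g) \<longleftrightarrow> f \<cdot>\<^bsub>C\<^esub> q = g \<cdot>\<^bsub>C\<^esub> q"
      using can unfolding can_arrow_def by blast
    \<comment> \<open>Heredity enters here: the arrow \<open>q\<close> into \<open>A\<close> forces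
      its source into \<open>D\<close>, so the partition found in \<open>C\<close> is described by a
      morphism of \<open>D\<close>.\<close>
    have QD: "Q \<in> obj D"
      using hered[OF A Q] q by blast
    have qD: "q \<in> hom D Q A"
      using q hom_eq[OF QD A] by simp
    have comp_eq: "f \<cdot>\<^bsub>D\<^esub> q = f \<cdot>\<^bsub>C\<^esub> q" if "f \<in> hom D A B" for f
      using sub that qD by (auto simp: subcategory_def hom_def)
    show "\<exists>w \<in> hom D B Y. \<exists>Q \<in> obj D. \<exists>q \<in> hom D Q A. \<forall>f \<in> hom D A B. \<forall>g \<in> hom D A B.
        \<chi> (w \<cdot>\<^bsub>D\<^esub> f) = \<chi> (w \<cdot>\<^bsub>D\<^esub> g) \<longleftrightarrow> f \<cdot>\<^bsub>D\<^esub> q = g \<cdot>\<^bsub>D\<^esub> q"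
    proof (intro bexI ballI)
      fix f g assume fg: "f \<in> hom D A B" "g \<in> hom D A B"
      then have "f \<in> hom C A B" "g \<in> hom C A B"
        using hom_eq[OF A B] by auto
      then show "\<chi> (k w \<cdot>\<^bsub>D\<^esub> f) = \<chi> (k w \<cdot>\<^bsub>D\<^esub> g) \<longleftrightarrow> f \<cdot>\<^bsub>D\<^esub> q = g \<cdot>\<^bsub>D\<^esub> q"
        using canon[of f g] pull[OF w] comp_eq fg by simp
    qed (use k[OF w] QD qD in auto)
  qed
  with Y show "\<exists>X \<in> obj D. can_arrow D X B A" ..
qed

end
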